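(* Let $\alpha$ be irrational, let $(a_n)_{n\ge1}$ be an increasing (not necessarily strictly increasing) sequence of integers and let $(\{a_n\alpha\})_{n\ge 1}$ be uniformly distributed modulo 1. If $$\lim_{n\rightarrow \infty}\frac{a_n}{n} = 0,$$ then every interval $[a,b) \subset [0,1)$ of positive measure is an S-NBRS for the sequence $(\{a_n\alpha\})_{n\ge 1}$.
   Context: $\mathbb{N}=\{1,2,\dots\}$; $\{x\}$ denotes the fractional part of $x$. A sequence $(x_n)_{n\ge1}$ in $[0,1)$ is uniformly distributed modulo 1 if $\lim_{N\to\infty}\frac1N\#\{1\le n\le N:x_n\in[a,b)\}=b-a$ for every interval $[a,b)\subseteq[0,1)$. An interval $[a,b)\subset[0,1)$ is a strongly non-bounded remainder set (S-NBRS) for $(x_n)_{n\ge1}$ if for all $K\in\mathbb{N}$ there are $K$ successive elements of $(x_n)_{n\ge1}$ which all are contained in $[a,b)$ or which all are not contained in $[a,b)$. *)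

theory Defs
  imports "HOL-Analysis.Analysis"
begin

text \<open>
  A sequence \<open>(x\<^sub>n)\<close> with \<open>n \<ge> 1\<close> is a function on \<^typ>\<open>nat\<close> whose value at 0 is ignored.
\<close>

definition uniformly_distributed_mod1 :: "(nat \<Rightarrow> real) \<Rightarrow> bool" where
  "uniformly_distributed_mod1 x \<longleftrightarrow>
     (\<forall>n\<ge>1. x n \<in> {0..<1}) \<and>
     (\<forall>a b. 0 \<le> a \<and> a \<le> b \<and> b \<le> 1 \<longrightarrow>
        (\<lambda>N. real (card {n \<in> {1..N}. x n \<in> {a..<b}}) / real N) \<longlonglongrightarrow> b - a)"

text \<open>Strongly non-bounded remainder sets.\<close>

definition S_NBRS :: "real set \<Rightarrow> (nat \<Rightarrow> real) \<Rightarrow> bool" where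
  "S_NBRS I x \<longleftrightarrow>
     (\<exists>a b. I = {a..<b}) \<and> I \<subseteq> {0..<1} \<and>
     (\<forall>K\<ge>1. \<exists>m\<ge>1. (\<forall>n\<in>{m..<m + K}. x n \<in> I) \<or> (\<forall>n\<in>{m..<m + K}. x n \<notin> I))"

end

theory Submission
  imports Defs "HOL-Real_Asymp.Real_Asymp"
begin

text \<open>
  A nondecreasing integer sequence that is \<open>o(n)\<close> must stand still for arbitrarily long
  stretches: if it moved at least once in every window of \<open>K\<close> steps, each move would contribute
  at least 1, and the sequence would grow at least like \<open>n / K\<close>. On a stretch where \<open>a\<close> is
  constant, the points \<open>{a\<^sub>n \<alpha>}\<close> all coincide, so they lie together inside or together outside
  any given interval.
\<close>

text \<open>
  Integrality is essential here: it turns ``not constant on a window'' into ``grows by at least 1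
  over that window''. Sampling along \<open>1 + j K\<close> then makes \<open>a\<^sub>n / n\<close> asymptotically at least \<open>1 / K\<close>.
\<close>

lemma sublinear_mono_int_seq_has_long_constant_runs:
  fixes a :: "nat \<Rightarrow> int"
  assumes mono: "mono_on {1..} a"
    and sublinear: "(\<lambda>n. of_int (a n) / real n) \<longlonglongrightarrow> (0 :: real)"
    and "K \<ge> 1"
  shows "\<exists>m\<ge>1. \<forall>n\<in>{m..m + K}. a n = a m"
proof (rule ccontr)
  assume no_run: "\<not> ?thesis"
  have step: "a m + 1 \<le> a (m + K)" if "m \<ge> 1" for m
  proof -
    obtain n where n: "n \<in> {m..m + K}" "a n \<noteq> a m"
      using no_run \<open>m \<ge> 1\<close> by blast
    have "a m \<le> a n" "a n \<le> a (m + K)"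
      using n \<open>m \<ge> 1\<close> by (simp_all add: mono_onD[OF mono])
    with n show ?thesis by linarith
  qed
  have growth: "a 1 + int j \<le> a (1 + j * K)" for j
  proof (induction j)
    case (Suc j)
    then show ?case using step[of "1 + j * K"] by (simp add: algebra_simps)
  qed simp
  have "strict_mono (\<lambda>j. 1 + j * K)"
    using \<open>K \<ge> 1\<close> by (simp add: strict_mono_def)
  from LIMSEQ_subseq_LIMSEQ[OF sublinear this]
  have upper: "(\<lambda>j. of_int (a (1 + j * K)) / real (1 + j * K)) \<longlonglongrightarrow> 0"
    by (simp add: o_def)
  have "real K > 0" using \<open>K \<ge> 1\<close> by simp
  then have lower: "(\<lambda>j. (of_int (a 1) + real j) / (1 + real j * real K)) \<longlonglongrightarrow> inverse (real K)"
    by real_asymp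
  have "(of_int (a 1) + real j) / (1 + real j * real K)
          \<le> of_int (a (1 + j * K)) / real (1 + j * K)" for j
  proof -
    have "of_int (a 1) + real j \<le> of_int (a (1 + j * K))"
      using growth[of j] by linarith
    then show ?thesis by (simp add: divide_right_mono)
  qed
  then have "inverse (real K) \<le> 0"
    using LIMSEQ_le[OF lower upper] by blast
  with \<open>real K > 0\<close> show False by simp
qed

theorem theorem4:
  fixes \<alpha> :: real and a :: "nat \<Rightarrow> int"
  assumes "\<alpha> \<notin> \<rat>"
    and "mono_on {1..} a"
    and "uniformly_distributed_mod1 (\<lambda>n. frac (of_int (a n) * \<alpha>))"
    and "(\<lambda>n. of_int (a n) / real n) \<longlonglongrightarrow> (0 :: real)"
  shows "\<forall>b c :: real. {b..<c} \<subseteq> {0..<1} \<and> measure lborel {b..<c} > 0 \<longrightarrow>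
           S_NBRS {b..<c} (\<lambda>n. frac (of_int (a n) * \<alpha>))"
proof (intro allI impI)
  fix b c :: real
  assume "{b..<c} \<subseteq> {0..<1} \<and> measure lborel {b..<c} > 0"
  then have sub: "{b..<c} \<subseteq> {0..<1}" by blast
  have "\<exists>m\<ge>1. (\<forall>n\<in>{m..<m + K}. frac (of_int (a n) * \<alpha>) \<in> {b..<c}) \<or>
               (\<forall>n\<in>{m..<m + K}. frac (of_int (a n) * \<alpha>) \<notin> {b..<c})" if K: "K \<ge> 1" for K
  proof -
    obtain m where "m \<ge> 1" and run: "\<forall>n\<in>{m..m + K}. a n = a m"
      using sublinear_mono_int_seq_has_long_constant_runs[OF assms(2,4) K] by blast
    have "a n = a m" if "n \<in> {m..<m + K}" for n
      by (rule bspec[OF run]) (use that in simp)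
    then have "frac (of_int (a n) * \<alpha>) = frac (of_int (a m) * \<alpha>)" if "n \<in> {m..<m + K}" for n
      using that by metis
    then show ?thesis
      using \<open>m \<ge> 1\<close> by metis
  qed
  then show "S_NBRS {b..<c} (\<lambda>n. frac (of_int (a n) * \<alpha>))"
    unfolding S_NBRS_def using sub by (intro conjI exI[of _ b] exI[of _ c]) simp_all
qed

end
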